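(* For every positive integer $n$, each of the following holds: (i) there is a red/blue coloring of $\mathbb{E}^n$ with no red congruent copy of $\ell_3$ and no blue congruent copy of $\ell_{20}$; (ii) there is a red/blue coloring of $\mathbb{E}^n$ with no red congruent copy of $\ell_4$ and no blue congruent copy of $\ell_{14}$; (iii) there is a red/blue coloring of $\mathbb{E}^n$ with no red congruent copy of $\ell_5$ and no blue congruent copy of $\ell_{8}$. In the usual notation: $\mathbb{E}^n \not\to (\ell_3,\ell_{20})$, $\mathbb{E}^n \not\to (\ell_4,\ell_{14})$ and $\mathbb{E}^n \not\to (\ell_5,\ell_{8})$.
   Context: $\mathbb{E}^n$ denotes $\mathbb{R}^n$ with the Euclidean norm. For an integer $m\ge 2$, $\ell_m$ denotes a configuration of $m$ collinear points with consecutive points at distance $1$, i.e. an $m$-term arithmetic progression with common difference $1$. A congruent copy of $\ell_m$ in $\mathbb{E}^n$ is a set $\{x_0,x_0+u,\dots,x_0+(m-1)u\}$ with $x_0\in\mathbb{E}^n$ and $|u|=1$. For configurations $K_1,\dots,K_r$, $\mathbb{E}^n\not\to(K_1,\dots,K_r)$ means that there is a coloring of $\mathbb{E}^n$ with $r$ colors such that for no $i$ is there a congruent copy of $K_i$ all of whose points have color $i$. *)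

theory Defs
  imports "HOL-Analysis.Analysis"
begin

text \<open>
  A configuration is represented by the family of all its congruent copies in the ambient space.
  For the configuration \<open>\<ell>\<^sub>m\<close> these are the \<open>m\<close>-term arithmetic progressions
  \<open>{x, x + u, \<dots>, x + (m - 1) u}\<close> whose common difference \<open>u\<close> is a unit vector.
\<close>

definition ell :: "nat \<Rightarrow> (real ^ 'n) set set" where
  "ell m = {S. \<exists>x u. norm u = 1 \<and> S = (\<lambda>j. x + real j *\<^sub>R u) ` {..<m}}"

text \<open>
  \<open>not_arrows [K\<^sub>1, \<dots>, K\<^sub>r]\<close> is \<open>\<bbbE>\<^sup>n \<not>\<rightarrow> (K\<^sub>1, \<dots>, K\<^sub>r)\<close>, with \<open>n = CARD('n)\<close>. The colors are
  numbered from \<open>0\<close>, like list positions: for two colors, \<open>0\<close> is red and \<open>1\<close> is blue.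
\<close>

definition not_arrows :: "(real ^ 'n) set set list \<Rightarrow> bool" where
  "not_arrows Ks \<longleftrightarrow>
    (\<exists>c :: real ^ 'n \<Rightarrow> nat. (\<forall>x. c x < length Ks) \<and>
      (\<forall>i < length Ks. \<not> (\<exists>S \<in> Ks ! i. \<forall>x \<in> S. c x = i)))"

end

theory Submission
  imports Defs
begin

text \<open>
  Color \<open>x\<close> red iff \<open>c \<bar>x\<bar>\<^sup>2\<close> lies in \<open>[0, L)\<close> modulo \<open>N\<close>, where \<open>(N, c, L)\<close> is \<open>(29, 7, 7)\<close>,
  \<open>(29, 10, 9)\<close> and \<open>(5, 2, 2)\<close>, respectively (found by computer search). Along a progression with
  unit step, \<open>c \<bar>x + k u\<bar>\<^sup>2 = \<alpha> + \<beta> k + c k\<^sup>2\<close>, so a monochromatic copy confines the affine function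
  \<open>\<alpha> + \<beta> k\<close>, for each \<open>k\<close>, to one of the windows \<open>[l, l + W)\<close> with \<open>l \<equiv> s - c k\<^sup>2\<close> modulo \<open>N\<close>. Changing
  \<open>\<alpha>\<close> and \<open>\<beta>\<close> by multiples of \<open>N\<close>, the windows for \<open>k = 0\<close> and \<open>k = 1\<close> may be fixed. A finite tree
  search over the remaining windows then finds no consistent choice. By Helly's theorem in the plane
  of the pairs \<open>(\<alpha>, \<beta>)\<close>, little is lost by testing consistency on triples of windows only.
\<close>

text \<open>For positions \<open>i < j < k\<close> this is exactly the condition for some affine
  function to meet all three half-open windows: the chord through the lower ends at \<open>i\<close>
  and \<open>k\<close> passes below the top of the window at \<open>j\<close>, and the chord through
  the upper ends passes above its bottom. Clearing denominators keeps the test in the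
  integers.\<close>

definition window_triple :: "int \<Rightarrow> int \<times> int \<Rightarrow> int \<times> int \<Rightarrow> int \<times> int \<Rightarrow> bool" where
  "window_triple W = (\<lambda>(i, a) (j, b) (k, l). i < j \<longrightarrow> j < k \<longrightarrow>
     (k - j) * a + (j - i) * l < (k - i) * (b + W) \<and>
     (k - i) * b < (k - j) * (a + W) + (j - i) * (l + W))"

text \<open>Entries are (position, lower end of the window), latest first. A branch is refuted only
  by pruning; exhausting the depth means that a full choice of windows survived, hence
  \<open>False\<close>.\<close>

fun refutes :: "int \<Rightarrow> int \<Rightarrow> int \<Rightarrow> int \<Rightarrow> nat \<Rightarrow> (int \<times> int) list \<Rightarrow> bool" where
  "refutes N c s W (Suc n) ((j, b) # (i, a) # ps) \<longleftrightarrow>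
     (let k = j + 1; d = s - c * k\<^sup>2; e = 2 * b - a - d in
      list_all (\<lambda>t. let p = (k, d + N * t); qs = (j, b) # (i, a) # ps in
          if list_all (\<lambda>q. list_all (\<lambda>r. window_triple W r q p) qs) qs
          then refutes N c s W n (p # qs) else True)
        [(e - 2 * W) div N..(e + 2 * W) div N])"
| "refutes _ _ _ _ _ _ \<longleftrightarrow> False"

definition no_run :: "int \<Rightarrow> int \<Rightarrow> int \<Rightarrow> int \<Rightarrow> nat \<Rightarrow> bool" where
  "no_run N c s W m \<longleftrightarrow> refutes N c s W (m - 2) [(1, s - c), (0, s)]"

definition in_window :: "real \<Rightarrow> real \<Rightarrow> int \<Rightarrow> int \<times> int \<Rightarrow> bool" where
  "in_window \<alpha> \<beta> W = (\<lambda>(k, l). of_int l \<le> \<alpha> + \<beta> * of_int k \<and> \<alpha> + \<beta> * of_int k < of_int (l + W))"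

lemma window_triple_if_in_window:
  assumes "in_window \<alpha> \<beta> W p" "in_window \<alpha> \<beta> W q" "in_window \<alpha> \<beta> W r"
  shows "window_triple W p q r"
proof -
  obtain i a j b k l where pqr: "p = (i, a)" "q = (j, b)" "r = (k, l)"
    by (metis surj_pair)
  have "(k - j) * a + (j - i) * l < (k - i) * (b + W) \<and>
     (k - i) * b < (k - j) * (a + W) + (j - i) * (l + W)" if "i < j" "j < k"
  proof -
    define f where "f x = \<alpha> + \<beta> * real_of_int x" for x
    \<comment> \<open>The opposite gaps are the weights that express \<open>f j\<close> as a mean of
      \<open>f i\<close> and \<open>f k\<close>.\<close>
    define u v where "u = real_of_int (k - j)" and "v = real_of_int (j - i)"
    have pos: "u > 0" "v > 0"
      using that by (auto simp: u_def v_def)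
    have affine: "u * f i + v * f k = (u + v) * f j"
      by (simp add: u_def v_def f_def algebra_simps)
    have bounds: "of_int a \<le> f i" "f i < of_int (a + W)" "of_int b \<le> f j" "f j < of_int (b + W)"
      "of_int l \<le> f k" "f k < of_int (l + W)"
      using assms by (simp_all add: pqr in_window_def f_def)
    have "u * of_int a + v * of_int l \<le> (u + v) * f j"
      unfolding affine[symmetric] using pos bounds by (intro add_mono mult_left_mono) auto
    also have "\<dots> < (u + v) * of_int (b + W)"
      using pos bounds by (intro mult_strict_left_mono) auto
    finally have 1: "u * of_int a + v * of_int l < (u + v) * of_int (b + W)" .
    have "(u + v) * of_int b \<le> u * f i + v * f k"
      unfolding affine using pos bounds by (intro mult_left_mono) auto
    also have "\<dots> < u * of_int (a + W) + v * of_int (l + W)"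
      using pos bounds by (intro add_strict_mono mult_strict_left_mono) auto
    finally have 2: "(u + v) * of_int b < u * of_int (a + W) + v * of_int (l + W)" .
    have sum: "u + v = of_int (k - i)"
      by (simp add: u_def v_def)
    show ?thesis
      using 1 2 unfolding sum unfolding u_def v_def
      by (simp only: of_int_mult[symmetric] of_int_add[symmetric] of_int_less_iff)
  qed
  then show ?thesis
    by (simp add: pqr window_triple_def)
qed

text \<open>The windows actually visited by \<alpha> + \<beta> k trace a branch that is never
  pruned, so the search would reach depth 0, where it fails.\<close>

lemma refutes_sound:
  assumes "refutes N c s W n ps" "N > 0"
    and "\<forall>p \<in> set ps. in_window \<alpha> \<beta> W p"
    and "fst (ps ! 0) = fst (ps ! 1) + 1"
    and "\<And>k. fst (hd ps) < k \<Longrightarrow> k \<le> fst (hd ps) + int n \<Longrightarrow>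
           \<exists>t. in_window \<alpha> \<beta> W (k, s - c * k\<^sup>2 + N * t)"
  shows False
  using assms
proof (induction N c s W n ps rule: refutes.induct)
  case (1 N c s W n j b i a ps)
  define qs where "qs = (j, b) # (i, a) # ps"
  define d where "d = s - c * (j + 1)\<^sup>2"
  define e where "e = 2 * b - a - d"
  have ji: "j = i + 1"
    using "1.prems"(4) by simp
  have W: "in_window \<alpha> \<beta> W (j, b)" "in_window \<alpha> \<beta> W (i, a)"
    using "1.prems"(3) by auto
  obtain t where t: "in_window \<alpha> \<beta> W (j + 1, d + N * t)"
    using "1.prems"(5)[of "j + 1"] by (auto simp: d_def)
  \<comment> \<open>An affine function has vanishing second difference, so its value at
    \<open>j + 1\<close> is determined by those at \<open>j\<close> and \<open>i\<close>; the slack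
    of the three windows adds up to less than \<open>2 * W\<close> on either side.\<close>
  have "real_of_int (e - 2 * W) < of_int (N * t)" "real_of_int (N * t) < of_int (e + 2 * W)"
    using W t by (auto simp: in_window_def e_def ji algebra_simps)
  then have "e - 2 * W \<le> N * t" "N * t \<le> e + 2 * W"
    by linarith+
  then have "(e - 2 * W) div N \<le> t" "t \<le> (e + 2 * W) div N"
    using \<open>N > 0\<close> zdiv_mono1[of "e - 2 * W" "N * t" N] zdiv_mono1[of "N * t" "e + 2 * W" N] by auto
  then have t_in: "t \<in> set [(e - 2 * W) div N..(e + 2 * W) div N]"
    by simp
  have triples: "list_all (\<lambda>q. list_all (\<lambda>r. window_triple W r q (j + 1, d + N * t)) qs) qs"
    using "1.prems"(3) t by (auto simp: list_all_iff qs_def[symmetric] intro: window_triple_if_in_window)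
  have "list_all (\<lambda>t. if list_all (\<lambda>q. list_all (\<lambda>r. window_triple W r q (j + 1, d + N * t)) qs) qs
      then refutes N c s W n ((j + 1, d + N * t) # qs) else True) [(e - 2 * W) div N..(e + 2 * W) div N]"
    using "1.prems"(1) by (simp only: refutes.simps(1) Let_def d_def e_def qs_def)
  then have "refutes N c s W n ((j + 1, d + N * t) # qs)"
    using t_in triples unfolding list_all_iff[of _ "[_.._]"] by metis
  then show False
  proof (rule "1.IH"[OF refl d_def e_def t_in refl qs_def triples])
    fix k
    assume "fst (hd ((j + 1, d + N * t) # qs)) < k" "k \<le> fst (hd ((j + 1, d + N * t) # qs)) + int n"
    then show "\<exists>t. in_window \<alpha> \<beta> W (k, s - c * k\<^sup>2 + N * t)"
      by (intro "1.prems"(5)) auto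
  qed (use t "1.prems" in \<open>auto simp: qs_def\<close>)
qed auto

lemma no_run_sound:
  assumes check: "no_run N c s W m" and "N > 0" "m \<ge> 2"
    and runs: "\<And>k. k < m \<Longrightarrow> \<exists>t. of_int (s + N * t) \<le> \<alpha> + \<beta> * real k + of_int c * (real k)\<^sup>2 \<and>
                            \<alpha> + \<beta> * real k + of_int c * (real k)\<^sup>2 < of_int (s + N * t + W)"
  shows False
proof -
  obtain t where t: "in_window \<alpha> \<beta> W (int k, s - c * (int k)\<^sup>2 + N * t k)" if "k < m" for k
  proof -
    have "\<exists>t. in_window \<alpha> \<beta> W (int k, s - c * (int k)\<^sup>2 + N * t)" if "k < m" for k
      using runs[OF that] by (auto simp: in_window_def algebra_simps)
    then show thesis
      using that by metis
  qed
  define \<alpha>' \<beta>' where "\<alpha>' = \<alpha> - of_int (N * t 0)" and "\<beta>' = \<beta> - of_int (N * (t 1 - t 0))"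
  \<comment> \<open>The subtracted multiple of \<open>N\<close> is itself affine in \<open>k\<close>
    and interpolates \<open>N * t k\<close> at 0 and 1, so the new shift vanishes there.\<close>
  have t': "in_window \<alpha>' \<beta>' W (int k, s - c * (int k)\<^sup>2 + N * (t k - t 0 - int k * (t 1 - t 0)))"
    if "k < m" for k
    using t[OF that] by (simp add: in_window_def \<alpha>'_def \<beta>'_def algebra_simps)
  show False
  proof (rule refutes_sound[OF check[unfolded no_run_def] \<open>N > 0\<close>])
    show "\<forall>p \<in> set [(1, s - c), (0, s)]. in_window \<alpha>' \<beta>' W p"
      using t'[of 0] t'[of 1] \<open>m \<ge> 2\<close> by simp
    fix k :: int
    assume "fst (hd [(1 :: int, s - c), (0, s)]) < k" "k \<le> fst (hd [(1, s - c), (0, s)]) + int (m - 2)"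
    then show "\<exists>t. in_window \<alpha>' \<beta>' W (k, s - c * k\<^sup>2 + N * t)"
      using t'[of "nat k"] \<open>m \<ge> 2\<close> by (intro exI[of _ "t (nat k) - t 0 - k * (t 1 - t 0)"]) auto
  qed simp
qed

lemma not_arrows_if_no_run:
  assumes red: "no_run N c 0 L r" "r \<ge> 2" and blue: "no_run N c L (N - L) b" "b \<ge> 2" and "N > 0"
  shows "not_arrows [ell r :: (real ^ 'n) set set, ell b]"
proof -
  define is_red where "is_red v \<longleftrightarrow> (\<exists>t. of_int (N * t) \<le> v \<and> v < of_int (N * t + L))" for v :: real
  define color :: "real ^ 'n \<Rightarrow> nat" where
    "color x = (if is_red (of_int c * (norm x)\<^sup>2) then 0 else 1)" for x
  have is_blue: "\<exists>t. of_int (L + N * t) \<le> v \<and> v < of_int (L + N * t + (N - L))" if "\<not> is_red v" for v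
  proof -
    \<comment> \<open>\<open>t\<close> indexes the period containing \<open>v\<close>; outside its
      red part \<open>[0, L)\<close>, the rest \<open>[L, N)\<close> is one window of width
      \<open>N - L\<close>.\<close>
    define t where "t = \<lfloor>v / of_int N\<rfloor>"
    have "of_int t \<le> v / of_int N" "v / of_int N < of_int t + 1"
      by (auto simp: t_def)
    then have "of_int (N * t) \<le> v" "v < of_int (N * t + N)"
      using \<open>N > 0\<close> by (simp_all add: field_simps)
    with that have "of_int (L + N * t) \<le> v \<and> v < of_int (L + N * t + (N - L))"
      by (auto simp: is_red_def not_less add.commute)
    then show ?thesis
      by blast
  qed
  \<comment> \<open>As \<open>u\<close> is a unit vector, the quadratic coefficient is always
    \<open>c\<close>; position, direction and dimension enter only through \<alpha> and
    \<beta>.\<close>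
  have quadratic: "of_int c * (norm (x + real k *\<^sub>R u))\<^sup>2 =
      of_int c * (norm x)\<^sup>2 + (2 * of_int c * (x \<bullet> u)) * real k + of_int c * (real k)\<^sup>2"
    if "norm u = 1" for x u :: "real ^ 'n" and k
  proof -
    have "u \<bullet> u = 1"
      using that by (simp add: dot_square_norm)
    then show ?thesis
      unfolding power2_norm_eq_inner
      by (simp add: inner_add_left inner_add_right inner_commute[of u x]
          power2_eq_square algebra_simps)
  qed
  have no_red: False if "S \<in> ell r" "\<forall>x \<in> S. color x = 0" for S
  proof -
    obtain x u where xu: "norm u = 1" "S = (\<lambda>j. x + real j *\<^sub>R u) ` {..<r}"
      using \<open>S \<in> ell r\<close> by (auto simp: ell_def)
    have "is_red (of_int c * (norm (x + real k *\<^sub>R u))\<^sup>2)" if "k < r" for k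
      using \<open>\<forall>x \<in> S. color x = 0\<close> that xu(2) by (force simp: color_def split: if_splits)
    then show False
      using xu(1) by (intro no_run_sound[OF red(1) \<open>N > 0\<close> red(2)]) (simp add: is_red_def quadratic)
  qed
  have no_blue: False if "S \<in> ell b" "\<forall>x \<in> S. color x = 1" for S
  proof -
    obtain x u where xu: "norm u = 1" "S = (\<lambda>j. x + real j *\<^sub>R u) ` {..<b}"
      using \<open>S \<in> ell b\<close> by (auto simp: ell_def)
    have "\<not> is_red (of_int c * (norm (x + real k *\<^sub>R u))\<^sup>2)" if "k < b" for k
      using \<open>\<forall>x \<in> S. color x = 1\<close> that xu(2) by (force simp: color_def split: if_splits)
    note * = is_blue[OF this, unfolded quadratic[OF xu(1)]]
    show False
      by (rule no_run_sound[OF blue(1) \<open>N > 0\<close> blue(2) *])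
  qed
  have "\<not> (\<exists>S \<in> [ell r, ell b] ! i. \<forall>x \<in> S. color x = i)" if "i < 2" for i
  proof -
    have "i = 0 \<or> i = 1"
      using that by linarith
    then show ?thesis
    proof
      assume "i = 0"
      show ?thesis
        unfolding \<open>i = 0\<close> nth_Cons_0 using no_red by blast
    next
      assume "i = 1"
      show ?thesis
        unfolding \<open>i = 1\<close> nth_Cons_0 nth_Cons_Suc One_nat_def using no_blue by (metis One_nat_def)
    qed
  qed
  moreover have "color x < 2" for x
    by (simp add: color_def)
  ultimately show ?thesis
    unfolding not_arrows_def by (intro exI[of _ color]) (simp flip: numeral_2_eq_2)
qed

text \<open>In each pair the first search excludes red runs and the second blue ones; the blue width
  stays an unevaluated difference to match \<open>N - L\<close>.\<close>

lemma no_run_3_20: "no_run 29 7 0 7 3" "no_run 29 7 7 (29 - 7) 20"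
  by code_simp+

lemma no_run_4_14: "no_run 29 10 0 9 4" "no_run 29 10 9 (29 - 9) 14"
  by code_simp+

lemma no_run_5_8: "no_run 5 2 0 2 5" "no_run 5 2 2 (5 - 2) 8"
  by code_simp+

theorem theorem1p1:
  shows "not_arrows [ell 3 :: (real ^ 'n) set set, ell 20] \<and>
         not_arrows [ell 4 :: (real ^ 'n) set set, ell 14] \<and>
         not_arrows [ell 5 :: (real ^ 'n) set set, ell 8]"
  using not_arrows_if_no_run[OF no_run_3_20(1) _ no_run_3_20(2)]
    not_arrows_if_no_run[OF no_run_4_14(1) _ no_run_4_14(2)]
    not_arrows_if_no_run[OF no_run_5_8(1) _ no_run_5_8(2)]
  by simp

end
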